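(* Let $\mathcal{P}$ be a finite reduced polyhedral poset and $(\mathbf{X},\mathbf{A})=\{(X_v,A_v)\mid v\in V_\mathcal{P}\}$ be a collection of NDR-pairs of spaces. If $X_v\ne A_v$ for all $v\in V_\mathcal{P}$, then the natural map $$\operatorname{hocolim}_{\mathcal{P}}\,\mathcal{Z}^\mathcal{P}_{\mathbf{X},\mathbf{A}}\to\operatorname{colim}_{\mathcal{P}}\,\mathcal{Z}^\mathcal{P}_{\mathbf{X},\mathbf{A}}$$ is a homotopy equivalence.
   Context: A poset $\mathcal{P}$ is regarded as a small category with exactly one morphism $\iota_{x,y}\colon x\to y$ whenever $x\le y$. It is pointed if it has an initial (least) object $*$. A vertex is an object $v\ne *$ such that $y<v$ implies $y=*$. $V_\mathcal{P}$ is the set of vertices, and $V(x)=\{v\in V_\mathcal{P}\mid v\le x\}$. A finite pointed poset is polyhedral if for each $x$ the sub-poset $\mathcal{P}_{\le x}=\{y\mid y\le x\}$ is a lower semilattice (any two objects have a meet). It is reduced if $x\le y$ and $V(x)=V(y)$ imply $x=y$. $\mathcal{Z}^\mathcal{P}_{\mathbf{X},\mathbf{A}}\colon\mathcal{P}\to\mathbf{Top}$ is the functor with $\mathcal{Z}^\mathcal{P}_{\mathbf{X},\mathbf{A}}(x)=\prod_{v\in V_\mathcal{P}}Y_v$, where $Y_v=X_v$ if $v\in V(x)$ and $Y_v=A_v$ otherwise, sending $\iota_{x,y}$ to the obvious inclusion. *)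

theory Defs
  imports "HOL-Analysis.Analysis"
begin

section \<open>Finite posets\<close>

text \<open>A poset is a subset \<open>P\<close> of a type of class \<open>order\<close>, with the induced order.\<close>

definition pointed_poset :: "'p::order set \<Rightarrow> bool" where
  "pointed_poset P \<longleftrightarrow> (\<exists>z\<in>P. \<forall>x\<in>P. z \<le> x)"

definition base_point :: "'p::order set \<Rightarrow> 'p" where
  "base_point P = (THE z. z \<in> P \<and> (\<forall>x\<in>P. z \<le> x))"

lemma base_point_eq:
  assumes "z \<in> P" "\<And>x. x \<in> P \<Longrightarrow> z \<le> x"
  shows "base_point P = z"
  unfolding base_point_def using assms by (intro the_equality) (auto intro: order.antisym)

definition poset_vertices :: "'p::order set \<Rightarrow> 'p set" where
  "poset_vertices P =
     {v \<in> P. v \<noteq> base_point P \<and> (\<forall>y\<in>P. y < v \<longrightarrow> y = base_point P)}"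

definition vertices_below :: "'p::order set \<Rightarrow> 'p \<Rightarrow> 'p set" where
  "vertices_below P x = {v \<in> poset_vertices P. v \<le> x}"

definition has_meets :: "'p::order set \<Rightarrow> bool" where
  "has_meets S \<longleftrightarrow>
     (\<forall>a\<in>S. \<forall>b\<in>S. \<exists>m\<in>S. m \<le> a \<and> m \<le> b \<and> (\<forall>c\<in>S. c \<le> a \<and> c \<le> b \<longrightarrow> c \<le> m))"

definition polyhedral_poset :: "'p::order set \<Rightarrow> bool" where
  "polyhedral_poset P \<longleftrightarrow>
     finite P \<and> pointed_poset P \<and> (\<forall>x\<in>P. has_meets {y \<in> P. y \<le> x})"

definition reduced_poset :: "'p::order set \<Rightarrow> bool" where
  "reduced_poset P \<longleftrightarrow>
     (\<forall>x\<in>P. \<forall>y\<in>P. x \<le> y \<and> vertices_below P x = vertices_below P y \<longrightarrow> x = y)"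


section \<open>NDR-pairs and homotopy equivalences\<close>

definition NDR_pair :: "'a topology \<Rightarrow> 'a set \<Rightarrow> bool" where
  "NDR_pair X A \<longleftrightarrow>
     A \<subseteq> topspace X \<and>
     (\<exists>u h. continuous_map X (top_of_set {0..1::real}) u \<and>
            A = {x \<in> topspace X. u x = 0} \<and>
            continuous_map (prod_topology (top_of_set {0..1::real}) X) X h \<and>
            (\<forall>x\<in>topspace X. h (0, x) = x) \<and>
            (\<forall>t\<in>{0..1}. \<forall>a\<in>A. h (t, a) = a) \<and>
            (\<forall>x\<in>topspace X. u x < 1 \<longrightarrow> h (1, x) \<in> A))"

definition homotopy_equivalence_map ::
    "'a topology \<Rightarrow> 'b topology \<Rightarrow> ('a \<Rightarrow> 'b) \<Rightarrow> bool" where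
  "homotopy_equivalence_map X Y f \<longleftrightarrow>
     continuous_map X Y f \<and>
     (\<exists>g. continuous_map Y X g \<and>
          homotopic_with (\<lambda>_. True) X X (g \<circ> f) id \<and>
          homotopic_with (\<lambda>_. True) Y Y (f \<circ> g) id)"


section \<open>Quotient spaces\<close>

definition equivalence_closure :: "('a \<times> 'a) set \<Rightarrow> ('a \<times> 'a) set" where
  "equivalence_closure R = (R \<union> R\<inverse>)\<^sup>*"

text \<open>The quotient of \<open>X\<close> by the equivalence relation generated by \<open>R\<close>, a relation on the
  points of \<open>X\<close>; the points of the quotient are the equivalence classes.\<close>

definition quotient_space :: "'a topology \<Rightarrow> ('a \<times> 'a) set \<Rightarrow> 'a set topology" where
  "quotient_space X R =
     topology (\<lambda>U. U \<subseteq> topspace X // equivalence_closure R \<and>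
                   openin X {x \<in> topspace X. equivalence_closure R `` {x} \<in> U})"

lemma openin_quotient_space:
  "openin (quotient_space X R) U \<longleftrightarrow>
     U \<subseteq> topspace X // equivalence_closure R \<and>
     openin X {x \<in> topspace X. equivalence_closure R `` {x} \<in> U}"
proof -
  let ?P = "\<lambda>U. U \<subseteq> topspace X // equivalence_closure R \<and>
                openin X {x \<in> topspace X. equivalence_closure R `` {x} \<in> U}"
  have int: "{x \<in> topspace X. equivalence_closure R `` {x} \<in> S \<inter> T} =
      {x \<in> topspace X. equivalence_closure R `` {x} \<in> S} \<inter>
      {x \<in> topspace X. equivalence_closure R `` {x} \<in> T}" for S T
    by auto
  have un: "{x \<in> topspace X. equivalence_closure R `` {x} \<in> \<Union>K} =
      (\<Union>S\<in>K. {x \<in> topspace X. equivalence_closure R `` {x} \<in> S})" for K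
    by auto
  have "istopology ?P"
    unfolding istopology_def int un by blast
  then show ?thesis
    unfolding quotient_space_def by simp
qed

lemma topspace_quotient_space:
  "topspace (quotient_space X R) = topspace X // equivalence_closure R"
proof -
  have "{x \<in> topspace X. equivalence_closure R `` {x} \<in> topspace X // equivalence_closure R} =
      topspace X"
    by (auto intro: quotientI)
  then have "openin (quotient_space X R) (topspace X // equivalence_closure R)"
    by (simp add: openin_quotient_space)
  then show ?thesis
    by (metis openin_quotient_space openin_subset openin_topspace subset_antisym)
qed


section \<open>Colimits and homotopy colimits of diagrams over a finite poset\<close>

text \<open>A functor from \<open>P\<close> to topological spaces is given by the spaces \<open>F x\<close> and the maps
  \<open>\<phi> x y\<close> from \<open>F x\<close> to \<open>F y\<close> for \<open>x \<le> y\<close>.\<close>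

definition poset_diagram ::
    "'p::order set \<Rightarrow> ('p \<Rightarrow> 'b topology) \<Rightarrow> ('p \<Rightarrow> 'p \<Rightarrow> 'b \<Rightarrow> 'b) \<Rightarrow> bool" where
  "poset_diagram P F \<phi> \<longleftrightarrow>
     (\<forall>x\<in>P. \<forall>y\<in>P. x \<le> y \<longrightarrow> continuous_map (F x) (F y) (\<phi> x y)) \<and>
     (\<forall>x\<in>P. \<forall>a\<in>topspace (F x). \<phi> x x a = a) \<and>
     (\<forall>x\<in>P. \<forall>y\<in>P. \<forall>z\<in>P. x \<le> y \<and> y \<le> z \<longrightarrow>
        (\<forall>a\<in>topspace (F x). \<phi> y z (\<phi> x y a) = \<phi> x z a))"

definition colim_rel ::
    "'p::order set \<Rightarrow> ('p \<Rightarrow> 'b topology) \<Rightarrow> ('p \<Rightarrow> 'p \<Rightarrow> 'b \<Rightarrow> 'b) \<Rightarrow>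
     (('p \<times> 'b) \<times> ('p \<times> 'b)) set" where
  "colim_rel P F \<phi> =
     {((x, a), (y, \<phi> x y a)) | x y a. x \<in> P \<and> y \<in> P \<and> x \<le> y \<and> a \<in> topspace (F x)}"

definition colim ::
    "'p::order set \<Rightarrow> ('p \<Rightarrow> 'b topology) \<Rightarrow> ('p \<Rightarrow> 'p \<Rightarrow> 'b \<Rightarrow> 'b) \<Rightarrow> ('p \<times> 'b) set topology" where
  "colim P F \<phi> = quotient_space (sum_topology F P) (colim_rel P F \<phi>)"

text \<open>For \<open>S \<subseteq> P\<close> with \<open>P\<close> finite, \<open>nerve_space P S\<close> is the geometric realization of the nerve
  of the poset \<open>S\<close>: its nondegenerate simplices are the nonempty finite chains in \<open>S\<close>, and a
  point is recorded by its barycentric coordinates, extended by \<open>0\<close> to all of \<open>P\<close>. The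
  map induced by \<open>S \<subseteq> S'\<close> is thus the inclusion.\<close>

definition nerve_space :: "'p::order set \<Rightarrow> 'p set \<Rightarrow> ('p \<Rightarrow> real) topology" where
  "nerve_space P S =
     subtopology (powertop_real P)
       {t. (\<forall>z\<in>P. 0 \<le> t z) \<and> (\<Sum>z\<in>P. t z) = 1 \<and>
           {z \<in> P. t z \<noteq> 0} \<subseteq> S \<and>
           (\<forall>z\<in>P. \<forall>w\<in>P. t z \<noteq> 0 \<and> t w \<noteq> 0 \<longrightarrow> z \<le> w \<or> w \<le> z)}"

text \<open>The homotopy colimit is the Bousfield--Kan coend of \<open>F\<close> with the functor
  \<open>x \<mapsto> |N(x \<down> P)|\<close>, where \<open>x \<down> P = {z \<in> P. x \<le> z}\<close>: for \<open>x \<le> y\<close>, \<open>a \<in> F x\<close> and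
  \<open>t \<in> |N(y \<down> P)| \<subseteq> |N(x \<down> P)|\<close>, the points \<open>(a, t)\<close> over \<open>x\<close> and \<open>(\<phi> x y a, t)\<close> over \<open>y\<close> are
  identified.\<close>

definition hocolim_rel ::
    "'p::order set \<Rightarrow> ('p \<Rightarrow> 'b topology) \<Rightarrow> ('p \<Rightarrow> 'p \<Rightarrow> 'b \<Rightarrow> 'b) \<Rightarrow>
     (('p \<times> 'b \<times> ('p \<Rightarrow> real)) \<times> ('p \<times> 'b \<times> ('p \<Rightarrow> real))) set" where
  "hocolim_rel P F \<phi> =
     {((x, a, t), (y, \<phi> x y a, t)) | x y a t.
        x \<in> P \<and> y \<in> P \<and> x \<le> y \<and> a \<in> topspace (F x) \<and>
        t \<in> topspace (nerve_space P {z \<in> P. y \<le> z})}"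

definition hocolim ::
    "'p::order set \<Rightarrow> ('p \<Rightarrow> 'b topology) \<Rightarrow> ('p \<Rightarrow> 'p \<Rightarrow> 'b \<Rightarrow> 'b) \<Rightarrow>
     ('p \<times> 'b \<times> ('p \<Rightarrow> real)) set topology" where
  "hocolim P F \<phi> =
     quotient_space
       (sum_topology (\<lambda>x. prod_topology (F x) (nerve_space P {z \<in> P. x \<le> z})) P)
       (hocolim_rel P F \<phi>)"

text \<open>The natural map sends the class of \<open>(x, a, t)\<close> to the class of \<open>(x, a)\<close>. It is defined
  without choosing a representative, as the union of the classes of all
  \<open>(x, a)\<close> with \<open>(x, a, t)\<close> in the given class; these coincide by \<open>hocolim_to_colim_class\<close>.\<close>

definition hocolim_to_colim ::
    "'p::order set \<Rightarrow> ('p \<Rightarrow> 'b topology) \<Rightarrow> ('p \<Rightarrow> 'p \<Rightarrow> 'b \<Rightarrow> 'b) \<Rightarrow>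
     ('p \<times> 'b \<times> ('p \<Rightarrow> real)) set \<Rightarrow> ('p \<times> 'b) set" where
  "hocolim_to_colim P F \<phi> c =
     equivalence_closure (colim_rel P F \<phi>) `` ((\<lambda>(x, a, t). (x, a)) ` c)"

lemma hocolim_to_colim_class:
  "hocolim_to_colim P F \<phi> (equivalence_closure (hocolim_rel P F \<phi>) `` {(x, a, t)}) =
   equivalence_closure (colim_rel P F \<phi>) `` {(x, a)}"
proof -
  let ?pr = "\<lambda>(x, a, t). (x, a)"
  let ?E = "equivalence_closure (colim_rel P F \<phi>)"
  have step: "(?pr p, ?pr q) \<in> colim_rel P F \<phi>" if "(p, q) \<in> hocolim_rel P F \<phi>" for p q
    using that unfolding hocolim_rel_def colim_rel_def by force
  have cl: "(?pr p, ?pr q) \<in> ?E" if "(p, q) \<in> equivalence_closure (hocolim_rel P F \<phi>)" for p q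
    using that unfolding equivalence_closure_def
  proof (induction rule: rtrancl_induct)
    case (step q r)
    then have "(?pr q, ?pr r) \<in> colim_rel P F \<phi> \<union> (colim_rel P F \<phi>)\<inverse>"
      using \<open>\<And>p q. (p, q) \<in> hocolim_rel P F \<phi> \<Longrightarrow> (?pr p, ?pr q) \<in> colim_rel P F \<phi>\<close> by blast
    with step.IH show ?case
      by (rule rtrancl_into_rtrancl)
  qed simp
  have trans: "(p, r) \<in> ?E" if "(p, q) \<in> ?E" "(q, r) \<in> ?E" for p q r
    using that unfolding equivalence_closure_def by (rule rtrancl_trans)
  let ?H = "equivalence_closure (hocolim_rel P F \<phi>)"
  have refl: "((x, a, t), (x, a, t)) \<in> ?H"
    by (simp add: equivalence_closure_def)
  show ?thesis
  proof (intro set_eqI iffI)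
    fix r assume "r \<in> hocolim_to_colim P F \<phi> (?H `` {(x, a, t)})"
    then obtain q where "((x, a, t), q) \<in> ?H" "(?pr q, r) \<in> ?E"
      unfolding hocolim_to_colim_def by blast
    then show "r \<in> ?E `` {(x, a)}"
      using cl[of "(x, a, t)" q] trans by auto
  next
    fix r assume "r \<in> ?E `` {(x, a)}"
    moreover have "(x, a) \<in> ?pr ` (?H `` {(x, a, t)})"
      using refl by (intro image_eqI[where x = "(x, a, t)"]) auto
    ultimately show "r \<in> hocolim_to_colim P F \<phi> (?H `` {(x, a, t)})"
      unfolding hocolim_to_colim_def by (blast intro: ImageI)
  qed
qed


section \<open>The polyhedral product functor\<close>

definition polyhedral_functor ::
    "'p::order set \<Rightarrow> ('p \<Rightarrow> 'a topology) \<Rightarrow> ('p \<Rightarrow> 'a set) \<Rightarrow> 'p \<Rightarrow> ('p \<Rightarrow> 'a) topology" where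
  "polyhedral_functor P X A x =
     product_topology
       (\<lambda>v. if v \<in> vertices_below P x then X v else subtopology (X v) (A v))
       (poset_vertices P)"

definition polyhedral_inclusion :: "'p \<Rightarrow> 'p \<Rightarrow> ('p \<Rightarrow> 'a) \<Rightarrow> ('p \<Rightarrow> 'a)" where
  "polyhedral_inclusion x y = id"

lemma poset_diagram_polyhedral:
  "poset_diagram P (polyhedral_functor P X A) polyhedral_inclusion"
proof -
  have "continuous_map (polyhedral_functor P X A x) (polyhedral_functor P X A y) id"
    if "x \<le> y" for x y
    unfolding polyhedral_functor_def continuous_map_componentwise
  proof (intro conjI ballI)
    let ?Y = "\<lambda>x v. if v \<in> vertices_below P x then X v else subtopology (X v) (A v)"
    fix v assume v: "v \<in> poset_vertices P"
    have "continuous_map (?Y x v) (?Y y v) id"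
      using that by (auto simp: vertices_below_def continuous_map_from_subtopology)
    then have "continuous_map (product_topology (?Y x) (poset_vertices P)) (?Y y v)
                 (id \<circ> (\<lambda>f. f v))"
      using continuous_map_product_projection[OF v] by (rule continuous_map_compose[rotated])
    then show "continuous_map (product_topology (?Y x) (poset_vertices P)) (?Y y v)
                 (\<lambda>f. id f v)"
      by (simp add: o_def)
  qed (auto simp: PiE_def)
  then show ?thesis
    unfolding poset_diagram_def polyhedral_inclusion_def by simp
qed

end

theory Submission
  imports Defs
begin

text \<open>The natural map has an explicit homotopy inverse, built from the NDR data \<open>(u\<^sub>v, h\<^sub>v)\<close>.

A point of the homotopy colimit is a pair \<open>(a, t)\<close> in which \<open>t\<close> is a point of the nerve and \<open>a\<close> lies in
the product over the least element (the apex) of the chain on which \<open>t\<close> is supported. To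
lift a point \<open>a\<close> of the product over \<open>x\<close>, give each vertex \<open>v\<close> the weight \<open>u\<^sub>v (a\<^sub>v)\<close>; this weight vanishes
unless \<open>v \<le> x\<close>. For \<open>0 \<le> c < 1\<close> let \<open>m\<^sub>c\<close> be the least face of \<open>x\<close> that contains all
vertices of weight greater than \<open>c\<close>. It exists because there are meets below \<open>x\<close>, and it decreases as \<open>c\<close> grows.
Hence the faces \<open>m\<^sub>c\<close> form a chain below \<open>x\<close>, whose least element is the least face \<open>m\<close>
containing the vertices of weight \<open>1\<close>. There are barycentric coordinates, supported exactly on this chain,
that depend continuously on \<open>a\<close> and do not change when \<open>x\<close> is replaced by a larger element
(\<open>face_coordinates_in_nerve\<close>, \<open>continuous_map_face_coordinates\<close>, \<open>face_coordinates_independent\<close>).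
The end of the deformation, \<open>a' = (h\<^sub>v (1, a\<^sub>v))\<^sub>v\<close>, moves every coordinate of weight less
than \<open>1\<close> into \<open>A\<^sub>v\<close>, so it lies in the product over \<open>m\<close>. The pair of \<open>a'\<close> and the
coordinates is thus a point of the homotopy colimit: the value of the homotopy inverse.

The continuity of this map is the delicate point, because the apex jumps. But
the conditions "\<open>a'\<close> lies in the product over \<open>y\<close>" and "the coordinates are supported above \<open>y\<close>" are
closed, so for \<open>y\<close> in \<open>P\<close> they give a finite closed cover, and on each of its members one can work over the
fixed element \<open>y\<close> (\<open>continuous_map_hpoint\<close>).

One composite sends the class of \<open>(x, a)\<close> to that of \<open>(x, a')\<close>, and the deformation \<open>h\<close> joins it to the
identity. The other sends \<open>(a, t)\<close> to \<open>(a', t')\<close>, where \<open>t'\<close> is supported below the apex of \<open>t\<close>. The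
two supports together form a chain, so the segment from \<open>t'\<close> to \<open>t\<close> stays in the nerve and joins
\<open>(a', t')\<close> to \<open>(a', t)\<close>; the deformation \<open>h\<close> joins the latter to \<open>(a, t)\<close>.\<close>

section \<open>Maps out of glued spaces\<close>

abbreviation glue_class :: "('a \<times> 'a) set \<Rightarrow> 'a \<Rightarrow> 'a set" where
  "glue_class R p \<equiv> equivalence_closure R `` {p}"

text \<open>The map that \<open>f\<close> induces on classes; meaningful only for \<open>f\<close> constant on each class.\<close>
definition lift_class :: "('a \<Rightarrow> 'b) \<Rightarrow> 'a set \<Rightarrow> 'b" where
  "lift_class f c = the_elem (f ` c)"

lemma glue_class_eqI:
  assumes "(p, q) \<in> R"
  shows "glue_class R p = glue_class R q"
proof -
  have "(p, q) \<in> equivalence_closure R" "(q, p) \<in> equivalence_closure R"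
    using assms unfolding equivalence_closure_def by auto
  then show ?thesis
    unfolding equivalence_closure_def by (auto intro: rtrancl_trans)
qed

lemma lift_class_eq:
  assumes "\<And>p q. (p, q) \<in> R \<Longrightarrow> f p = f q"
  shows "lift_class f (glue_class R p) = f p"
proof -
  have "f q = f p" if "(p, q) \<in> equivalence_closure R" for q
    using that unfolding equivalence_closure_def
    by (induction rule: rtrancl_induct) (use assms in \<open>metis Un_iff converse_iff\<close>)+
  moreover have "p \<in> glue_class R p"
    by (simp add: equivalence_closure_def)
  ultimately have "f ` glue_class R p = {f p}"
    by blast
  then show ?thesis
    by (simp add: lift_class_def)
qed

lemma quotient_map_glue_class: "quotient_map X (quotient_space X R) (glue_class R)"
  unfolding quotient_map_def topspace_quotient_space openin_quotient_space
  by (auto simp: quotient_def)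

lemma continuous_map_from_sum_topology:
  assumes "\<And>i. i \<in> I \<Longrightarrow> continuous_map (G i) Y (\<lambda>a. f (i, a))"
  shows "continuous_map (sum_topology G I) Y f"
  unfolding continuous_map_def
proof (intro conjI allI impI)
  show "f \<in> topspace (sum_topology G I) \<rightarrow> topspace Y"
    using assms by (force simp: continuous_map_def)
next
  fix U assume U: "openin Y U"
  have "openin (G i) {a. (i, a) \<in> {p \<in> topspace (sum_topology G I). f p \<in> U}}" if "i \<in> I" for i
    using openin_continuous_map_preimage[OF assms[OF that] U] that by simp
  then show "openin (sum_topology G I) {p \<in> topspace (sum_topology G I). f p \<in> U}"
    by (auto simp: openin_sum_topology)
qed

text \<open>The pieces of a disjoint sum are open, so it suffices to check continuity on each of them, where the
projection to the summand is continuous.\<close>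
lemma continuous_map_from_prod_sum_topology:
  assumes "\<And>i. i \<in> I \<Longrightarrow> continuous_map (prod_topology Z (G i)) Y (\<lambda>(s, a). f (s, (i, a)))"
  shows "continuous_map (prod_topology Z (sum_topology G I)) Y f"
proof (rule pasting_lemma[where I = I and T = "\<lambda>i. topspace Z \<times> ({i} \<times> topspace (G i))"
      and f = "\<lambda>_. f"])
  fix i assume i: "i \<in> I"
  show "openin (prod_topology Z (sum_topology G I)) (topspace Z \<times> ({i} \<times> topspace (G i)))"
  proof -
    have "{a. (j, a) \<in> {i} \<times> topspace (G i)} = (if j = i then topspace (G i) else {})" for j
      by auto
    then have "openin (sum_topology G I) ({i} \<times> topspace (G i))"
      using i by (auto simp: openin_sum_topology)
    then show ?thesis
      by (simp add: openin_prod_Times_iff)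
  qed
  let ?W = "subtopology (prod_topology Z (sum_topology G I)) (topspace Z \<times> ({i} \<times> topspace (G i)))"
  have W: "topspace ?W = topspace Z \<times> ({i} \<times> topspace (G i))"
    using i by auto
  have snd: "continuous_map ?W (G i) (snd \<circ> snd)"
    unfolding continuous_map_def
  proof (intro conjI allI impI)
    show "snd \<circ> snd \<in> topspace ?W \<rightarrow> topspace (G i)"
      by auto
  next
    fix U assume U: "openin (G i) U"
    have "{a. (j, a) \<in> {i} \<times> U} = (if j = i then U else {})" for j
      by auto
    then have "openin (sum_topology G I) ({i} \<times> U)"
      using i U openin_subset[OF U] by (auto simp: openin_sum_topology)
    then have "openin (prod_topology Z (sum_topology G I)) (topspace Z \<times> ({i} \<times> U))"
      by (simp add: openin_prod_Times_iff)
    moreover have "{w \<in> topspace ?W. (snd \<circ> snd) w \<in> U} =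
        (topspace Z \<times> ({i} \<times> U)) \<inter> (topspace Z \<times> ({i} \<times> topspace (G i)))"
      using openin_subset[OF U] unfolding W by auto
    ultimately show "openin ?W {w \<in> topspace ?W. (snd \<circ> snd) w \<in> U}"
      unfolding openin_subtopology by blast
  qed
  have "continuous_map ?W Z fst"
    by (simp add: continuous_map_from_subtopology continuous_map_fst)
  then have "continuous_map ?W (prod_topology Z (G i)) (\<lambda>w. (fst w, (snd \<circ> snd) w))"
    using snd by (rule continuous_map_pairedI)
  from continuous_map_compose[OF this assms[OF i]]
  show "continuous_map ?W Y f"
    by (rule continuous_map_eq) (use W in auto)
qed auto

lemma continuous_map_from_glued:
  assumes cont: "\<And>i. i \<in> I \<Longrightarrow> continuous_map (G i) Y (\<lambda>a. f (i, a))"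
    and resp: "\<And>p q. (p, q) \<in> R \<Longrightarrow> f p = f q"
  shows "continuous_map (quotient_space (sum_topology G I) R) Y (lift_class f)"
proof -
  have "lift_class f \<circ> glue_class R = f"
    using lift_class_eq[of R f] resp by (auto simp: fun_eq_iff)
  then have "continuous_map (sum_topology G I) Y (lift_class f \<circ> glue_class R)"
    using continuous_map_from_sum_topology[OF cont] by simp
  then show ?thesis
    using quotient_map_glue_class continuous_compose_quotient_map by blast
qed

text \<open>A compatible family of homotopies on the pieces descends to the glued space: the
unit interval is locally compact and Hausdorff, so multiplying the quotient map by it gives a quotient map again.\<close>
lemma homotopic_with_glued:
  assumes cont: "\<And>i. i \<in> I \<Longrightarrow>
      continuous_map (prod_topology (top_of_set {0..1::real}) (G i)) Y (\<lambda>(s, a). H s (i, a))"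
    and resp: "\<And>s p q. s \<in> {0..1} \<Longrightarrow> (p, q) \<in> R \<Longrightarrow> H s p = H s q"
    and start: "\<And>i a. i \<in> I \<Longrightarrow> a \<in> topspace (G i) \<Longrightarrow> H 0 (i, a) = f (glue_class R (i, a))"
    and finish: "\<And>i a. i \<in> I \<Longrightarrow> a \<in> topspace (G i) \<Longrightarrow> H 1 (i, a) = g (glue_class R (i, a))"
  shows "homotopic_with (\<lambda>_. True) (quotient_space (sum_topology G I) R) Y f g"
proof -
  let ?S = "sum_topology G I" and ?I = "top_of_set {0..1::real}"
  let ?Q = "quotient_space ?S R"
  let ?K = "\<lambda>(s, c). lift_class (H s) c"
  have lift: "lift_class (H s) (glue_class R p) = H s p" if "s \<in> {0..1}" for s p
    using resp[OF that] by (rule lift_class_eq)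
  have "continuous_map (prod_topology ?I ?S) Y (\<lambda>(s, p). H s p)"
    using cont by (intro continuous_map_from_prod_sum_topology) auto
  then have "continuous_map (prod_topology ?I ?S) Y (?K \<circ> (\<lambda>(s, p). (s, glue_class R p)))"
    by (rule continuous_map_eq) (auto simp: lift)
  moreover have "quotient_map (prod_topology ?I ?S) (prod_topology ?I ?Q) (\<lambda>(s, p). (s, glue_class R p))"
    by (intro quotient_map_prod_right compact_imp_locally_compact_space quotient_map_glue_class)
      (auto simp: compact_space_subtopology Hausdorff_space_subtopology)
  ultimately have contK: "continuous_map (prod_topology ?I ?Q) Y ?K"
    by (rule continuous_compose_quotient_map[rotated])
  have "H 0 p = f (glue_class R p)" "H 1 p = g (glue_class R p)" if "p \<in> topspace ?S" for p
    using that start finish by auto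
  then have ends: "?K (0, c) = f c" "?K (1, c) = g c" if "c \<in> topspace ?Q" for c
    using that lift by (auto simp: topspace_quotient_space quotient_def)
  show ?thesis
    by (subst homotopic_with) (use contK ends in auto)
qed


section \<open>Faces of a polyhedral poset\<close>

lemma finite_polyhedral_poset: "polyhedral_poset P \<Longrightarrow> finite P"
  by (simp add: polyhedral_poset_def)

lemma finite_poset_vertices: "polyhedral_poset P \<Longrightarrow> finite (poset_vertices P)"
  by (simp add: polyhedral_poset_def poset_vertices_def)

lemma vertices_below_mono: "x \<le> y \<Longrightarrow> vertices_below P x \<subseteq> vertices_below P y"
  by (auto simp: vertices_below_def)

text \<open>Every vertex below both \<open>y\<close> and \<open>z\<close> is itself an element below \<open>x\<close>, hence lies below the meet.\<close>
lemma meet_exists: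
  assumes "polyhedral_poset P" "x \<in> P" "y \<in> P" "z \<in> P" "y \<le> x" "z \<le> x"
  obtains m where "m \<in> P" "m \<le> y" "m \<le> z"
    "vertices_below P m = vertices_below P y \<inter> vertices_below P z"
proof -
  have "has_meets {w \<in> P. w \<le> x}"
    using assms by (auto simp: polyhedral_poset_def)
  then obtain m where m: "m \<in> P" "m \<le> y" "m \<le> z"
    and greatest: "\<And>c. c \<in> P \<Longrightarrow> c \<le> x \<Longrightarrow> c \<le> y \<Longrightarrow> c \<le> z \<Longrightarrow> c \<le> m"
    unfolding has_meets_def using assms by blast
  have "vertices_below P m = vertices_below P y \<inter> vertices_below P z"
    using m greatest assms(5) unfolding vertices_below_def poset_vertices_def
    by (auto intro: order_trans)
  with m show thesis
    using that by blast
qed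

text \<open>The meet of two faces containing \<open>S\<close> again contains \<open>S\<close>, so a minimal such face is the least one.\<close>
lemma least_face_exists:
  assumes P: "polyhedral_poset P" and x: "x \<in> P" and S: "S \<subseteq> vertices_below P x"
  obtains m where "m \<in> P" "m \<le> x" "S \<subseteq> vertices_below P m"
    "\<And>z. z \<in> P \<Longrightarrow> z \<le> x \<Longrightarrow> S \<subseteq> vertices_below P z \<Longrightarrow> m \<le> z"
proof -
  let ?C = "{y \<in> P. y \<le> x \<and> S \<subseteq> vertices_below P y}"
  have "finite ?C" "?C \<noteq> {}"
    using P x S by (auto simp: finite_polyhedral_poset)
  then obtain m where m: "m \<in> ?C" and min: "\<And>y. y \<in> ?C \<Longrightarrow> y \<le> m \<Longrightarrow> m = y"
    using finite_has_minimal[of ?C] by auto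
  have "m \<le> z" if z: "z \<in> ?C" for z
  proof -
    obtain n where n: "n \<in> P" "n \<le> m" "n \<le> z"
        "vertices_below P n = vertices_below P m \<inter> vertices_below P z"
      using meet_exists[OF P x, of m z] m z by auto
    then have "n \<in> ?C"
      using m z by (auto intro: order_trans)
    with min n show ?thesis
      by blast
  qed
  with m that show thesis
    by blast
qed


section \<open>Barycentric coordinates read off from vertex weights\<close>

text \<open>The inserted \<open>0\<close> is the value at an element that lies above all vertices.\<close>
definition outer_weight :: "'p::order set \<Rightarrow> ('p \<Rightarrow> real) \<Rightarrow> 'p \<Rightarrow> real" where
  "outer_weight P \<kappa> z = Max (insert 0 (\<kappa> ` (poset_vertices P - vertices_below P z)))"

text \<open>For \<open>z \<le> x\<close> and vertex weights between \<open>0\<close> and \<open>1\<close>, the product is positive exactly when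
\<open>outer_weight P \<kappa> z\<close> is less than \<open>1\<close> and less than the outer weight of every smaller element. If
the weights vanish at all vertices that are not below \<open>x\<close>, this says that, for some \<open>0 \<le> c < 1\<close>, \<open>z\<close> is
the least face of \<open>x\<close> containing all vertices of weight greater than \<open>c\<close>: one can take \<open>c = outer_weight P \<kappa> z\<close>. Among the continuous functions with
this support a product is convenient, as it vanishes as soon as one factor does.\<close>
definition face_weight :: "'p::order set \<Rightarrow> 'p \<Rightarrow> ('p \<Rightarrow> real) \<Rightarrow> 'p \<Rightarrow> real" where
  "face_weight P x \<kappa> z =
     (if z \<le> x
      then (1 - outer_weight P \<kappa> z) *
           (\<Prod>y\<in>{y\<in>P. y < z}. outer_weight P \<kappa> y - outer_weight P \<kappa> z)
      else 0)"

definition face_coordinates :: "'p::order set \<Rightarrow> 'p \<Rightarrow> ('p \<Rightarrow> real) \<Rightarrow> 'p \<Rightarrow> real" where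
  "face_coordinates P x \<kappa> =
     (\<lambda>z\<in>P. face_weight P x \<kappa> z / (\<Sum>w\<in>P. face_weight P x \<kappa> w))"

text \<open>The vertex weights that occur for a point of the product over \<open>x\<close>.\<close>
definition weights_on :: "'p::order set \<Rightarrow> 'p \<Rightarrow> ('p \<Rightarrow> real) \<Rightarrow> bool" where
  "weights_on P x \<kappa> \<longleftrightarrow>
     (\<forall>v\<in>poset_vertices P. 0 \<le> \<kappa> v \<and> \<kappa> v \<le> 1) \<and>
     (\<forall>v\<in>poset_vertices P - vertices_below P x. \<kappa> v = 0)"

lemma outer_weight_less_iff:
  assumes "polyhedral_poset P" "0 < c"
  shows "outer_weight P \<kappa> z < c \<longleftrightarrow> (\<forall>v\<in>poset_vertices P - vertices_below P z. \<kappa> v < c)"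
  using assms finite_poset_vertices[of P] unfolding outer_weight_def by (subst Max_less_iff) auto

lemma outer_weight_le_iff:
  assumes "polyhedral_poset P" "0 \<le> c"
  shows "outer_weight P \<kappa> z \<le> c \<longleftrightarrow> (\<forall>v\<in>poset_vertices P - vertices_below P z. \<kappa> v \<le> c)"
  using assms finite_poset_vertices[of P] unfolding outer_weight_def by (subst Max_le_iff) auto

lemma outer_weight_nonneg:
  assumes "polyhedral_poset P"
  shows "0 \<le> outer_weight P \<kappa> z"
  using assms finite_poset_vertices[of P] unfolding outer_weight_def by (intro Max_ge) auto

lemma outer_weight_ge:
  assumes "polyhedral_poset P" "v \<in> poset_vertices P" "v \<notin> vertices_below P z"
  shows "\<kappa> v \<le> outer_weight P \<kappa> z"
  using assms finite_poset_vertices[of P] unfolding outer_weight_def by (intro Max_ge) auto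

lemma outer_weight_antimono:
  assumes "polyhedral_poset P" "y \<le> z"
  shows "outer_weight P \<kappa> z \<le> outer_weight P \<kappa> y"
  using assms vertices_below_mono[of y z P]
  by (subst outer_weight_le_iff) (auto intro: outer_weight_nonneg outer_weight_ge)

text \<open>A vertex that is not below the meet is missing from \<open>y\<close> or from \<open>z\<close>, so its
weight is at most the larger of their outer weights.\<close>
lemma outer_weight_meet:
  assumes P: "polyhedral_poset P"
    and m: "vertices_below P m = vertices_below P y \<inter> vertices_below P z"
    and le: "outer_weight P \<kappa> y \<le> outer_weight P \<kappa> z"
  shows "outer_weight P \<kappa> m \<le> outer_weight P \<kappa> z"
proof -
  have "\<kappa> v \<le> outer_weight P \<kappa> z" if "v \<in> poset_vertices P" "v \<notin> vertices_below P m" for v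
    using that outer_weight_ge[OF P, of v y \<kappa>] outer_weight_ge[OF P, of v z \<kappa>] le
    unfolding m by force
  then show ?thesis
    using P by (subst outer_weight_le_iff) (auto intro: outer_weight_nonneg)
qed

lemma face_weight_nonneg:
  assumes P: "polyhedral_poset P" and \<kappa>: "weights_on P x \<kappa>"
  shows "0 \<le> face_weight P x \<kappa> z"
proof -
  have "outer_weight P \<kappa> z \<le> 1"
    using P \<kappa> by (subst outer_weight_le_iff) (auto simp: weights_on_def)
  then show ?thesis
    unfolding face_weight_def
    by (auto intro!: mult_nonneg_nonneg prod_nonneg outer_weight_antimono[OF P])
qed

lemma face_weight_eq_0:
  assumes P: "polyhedral_poset P" and "y \<in> P" "y < z"
    and "outer_weight P \<kappa> y \<le> outer_weight P \<kappa> z"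
  shows "face_weight P x \<kappa> z = 0"
proof -
  have "outer_weight P \<kappa> y = outer_weight P \<kappa> z"
    using assms outer_weight_antimono[OF P, of y z \<kappa>] by simp
  then have "(\<Prod>y\<in>{y\<in>P. y < z}. outer_weight P \<kappa> y - outer_weight P \<kappa> z) = 0"
    using assms finite_polyhedral_poset[OF P] by (intro prod_zero) auto
  then show ?thesis
    by (simp add: face_weight_def)
qed

text \<open>Of two elements of the support, let \<open>b\<close> be the one of larger outer weight. Its meet with the other one has no larger
outer weight, so it cannot be strictly smaller than \<open>b\<close>.\<close>
lemma face_weight_chain:
  assumes P: "polyhedral_poset P" and x: "x \<in> P" and yz: "y \<in> P" "z \<in> P"
    and nz: "face_weight P x \<kappa> y \<noteq> 0" "face_weight P x \<kappa> z \<noteq> 0"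
  shows "y \<le> z \<or> z \<le> y"
proof -
  have below: "b \<le> a"
    if ab: "a \<in> P" "b \<in> P" and nz: "face_weight P x \<kappa> a \<noteq> 0" "face_weight P x \<kappa> b \<noteq> 0"
      and le: "outer_weight P \<kappa> a \<le> outer_weight P \<kappa> b" for a b
  proof -
    have "a \<le> x" "b \<le> x"
      using nz by (auto simp: face_weight_def split: if_splits)
    then obtain m where m: "m \<in> P" "m \<le> a" "m \<le> b"
        "vertices_below P m = vertices_below P a \<inter> vertices_below P b"
      using meet_exists[OF P x ab] by auto
    then have "\<not> m < b"
      using face_weight_eq_0[OF P m(1)] outer_weight_meet[OF P m(4) le] nz by blast
    with m show ?thesis
      by (simp add: order.strict_iff_order)
  qed
  show ?thesis
    using below[of y z] below[of z y] yz nz by linarith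
qed

text \<open>If \<open>z\<close> is a face of \<open>y\<close> but not of \<open>x\<close>, then its meet with \<open>x\<close> is strictly smaller and misses
no further vertex of positive weight, so a factor of the weight of \<open>z\<close> vanishes.\<close>
lemma face_weight_independent:
  assumes P: "polyhedral_poset P" and xy: "x \<in> P" "y \<in> P" "x \<le> y"
    and \<kappa>: "weights_on P x \<kappa>" and z: "z \<in> P"
  shows "face_weight P x \<kappa> z = face_weight P y \<kappa> z"
proof -
  have "face_weight P y \<kappa> z = 0" if zy: "z \<le> y" and zx: "\<not> z \<le> x"
  proof -
    obtain m where m: "m \<in> P" "m \<le> x" "m \<le> z"
        "vertices_below P m = vertices_below P x \<inter> vertices_below P z"
      using meet_exists[OF P xy(2,1) z xy(3) zy] by metis
    have "outer_weight P \<kappa> x \<le> outer_weight P \<kappa> z"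
      using P \<kappa> by (subst outer_weight_le_iff)
        (auto simp: weights_on_def intro: outer_weight_nonneg)
    then have "outer_weight P \<kappa> m \<le> outer_weight P \<kappa> z"
      using outer_weight_meet[OF P m(4)] by blast
    moreover have "m < z"
      using m zx by (auto simp: order.strict_iff_order)
    ultimately show ?thesis
      using face_weight_eq_0[OF P m(1)] by blast
  qed
  then show ?thesis
    using xy by (auto simp: face_weight_def dest: order_trans)
qed

lemma face_coordinates_independent:
  assumes "polyhedral_poset P" "x \<in> P" "y \<in> P" "x \<le> y" "weights_on P x \<kappa>"
  shows "face_coordinates P x \<kappa> = face_coordinates P y \<kappa>"
  unfolding face_coordinates_def
  using face_weight_independent[OF assms] by (auto intro!: restrict_ext)

text \<open>Every element strictly below the least face \<open>m\<close> containing the vertices of weight \<open>1\<close> misses such a vertex. It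
therefore has outer weight \<open>1\<close>, and so weight \<open>0\<close>, while \<open>m\<close> itself has positive weight.\<close>
lemma least_full_face:
  assumes P: "polyhedral_poset P" and x: "x \<in> P" and \<kappa>: "weights_on P x \<kappa>"
  obtains m where "m \<in> P" "m \<le> x" "{v \<in> poset_vertices P. \<kappa> v = 1} \<subseteq> vertices_below P m"
    "0 < face_weight P x \<kappa> m"
    "\<And>z. z \<in> P \<Longrightarrow> face_weight P x \<kappa> z \<noteq> 0 \<Longrightarrow> m \<le> z"
proof -
  let ?S = "{v \<in> poset_vertices P. \<kappa> v = 1}"
  have "?S \<subseteq> vertices_below P x"
    using \<kappa> by (force simp: weights_on_def)
  then obtain m where m: "m \<in> P" "m \<le> x" "?S \<subseteq> vertices_below P m"
    and least: "\<And>z. z \<in> P \<Longrightarrow> z \<le> x \<Longrightarrow> ?S \<subseteq> vertices_below P z \<Longrightarrow> m \<le> z"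
    using least_face_exists[OF P x] by blast
  have small: "outer_weight P \<kappa> m < 1"
    using P \<kappa> m(3) by (subst outer_weight_less_iff) (force simp: weights_on_def)+
  have full: "1 \<le> outer_weight P \<kappa> y" if y: "y \<in> P" "y < m" for y
  proof -
    have "y \<le> x" "\<not> m \<le> y"
      using y m(2) by auto
    with least[OF y(1)] have "\<not> ?S \<subseteq> vertices_below P y"
      by blast
    then obtain v where "v \<in> poset_vertices P" "\<kappa> v = 1" "v \<notin> vertices_below P y"
      by blast
    then show ?thesis
      using outer_weight_ge[OF P, of v y \<kappa>] by simp
  qed
  have pos: "0 < face_weight P x \<kappa> m"
    unfolding face_weight_def using m(2) small less_le_trans[OF small full]
    by (auto intro!: mult_pos_pos prod_pos)
  have "m \<le> z" if z: "z \<in> P" "face_weight P x \<kappa> z \<noteq> 0" for z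
  proof -
    have "\<not> z < m"
    proof
      assume "z < m"
      moreover have "outer_weight P \<kappa> z \<le> 1"
        using P \<kappa> by (subst outer_weight_le_iff) (auto simp: weights_on_def)
      ultimately have "outer_weight P \<kappa> z = 1"
        using full[OF z(1)] by simp
      with z(2) show False
        by (simp add: face_weight_def split: if_splits)
    qed
    moreover have "z \<le> m \<or> m \<le> z"
      using face_weight_chain[OF P x] z m(1) pos by force
    ultimately show ?thesis
      by (auto simp: order.strict_iff_order)
  qed
  with m pos that show thesis
    by blast
qed

lemma sum_face_weight_pos:
  assumes P: "polyhedral_poset P" and x: "x \<in> P" and \<kappa>: "weights_on P x \<kappa>"
  shows "0 < (\<Sum>z\<in>P. face_weight P x \<kappa> z)"
proof -
  obtain m where "m \<in> P" "0 < face_weight P x \<kappa> m"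
    using least_full_face[OF P x \<kappa>] by metis
  then show ?thesis
    using P by (intro sum_pos2) (auto simp: finite_polyhedral_poset face_weight_nonneg[OF P \<kappa>])
qed

lemma topspace_nerve_space:
  "t \<in> topspace (nerve_space P S) \<longleftrightarrow>
     t \<in> extensional P \<and> (\<forall>z\<in>P. 0 \<le> t z) \<and> (\<Sum>z\<in>P. t z) = 1 \<and>
     (\<forall>z\<in>P. t z \<noteq> 0 \<longrightarrow> z \<in> S) \<and>
     (\<forall>z\<in>P. \<forall>w\<in>P. t z \<noteq> 0 \<and> t w \<noteq> 0 \<longrightarrow> z \<le> w \<or> w \<le> z)"
  unfolding nerve_space_def by (auto simp: PiE_def)

lemma face_coordinates_in_nerve:
  assumes P: "polyhedral_poset P" and x: "x \<in> P" and \<kappa>: "weights_on P x \<kappa>"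
  obtains m where "m \<in> P" "m \<le> x" "{v \<in> poset_vertices P. \<kappa> v = 1} \<subseteq> vertices_below P m"
    "face_coordinates P x \<kappa> \<in> topspace (nerve_space P {z \<in> P. m \<le> z \<and> z \<le> x})"
proof -
  obtain m where m: "m \<in> P" "m \<le> x" "{v \<in> poset_vertices P. \<kappa> v = 1} \<subseteq> vertices_below P m"
    and above: "\<And>z. z \<in> P \<Longrightarrow> face_weight P x \<kappa> z \<noteq> 0 \<Longrightarrow> m \<le> z"
    using least_full_face[OF P x \<kappa>] by metis
  have sum: "0 < (\<Sum>z\<in>P. face_weight P x \<kappa> z)"
    by (rule sum_face_weight_pos[OF P x \<kappa>])
  have below: "face_weight P x \<kappa> z \<noteq> 0 \<Longrightarrow> z \<le> x" for z
    by (auto simp: face_weight_def split: if_splits)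
  have chain: "\<forall>z\<in>P. \<forall>w\<in>P. face_weight P x \<kappa> z \<noteq> 0 \<and> face_weight P x \<kappa> w \<noteq> 0 \<longrightarrow> z \<le> w \<or> w \<le> z"
    using face_weight_chain[OF P x] by blast
  have "(\<Sum>z\<in>P. face_coordinates P x \<kappa> z) = 1"
    using sum by (simp add: face_coordinates_def flip: sum_divide_distrib)
  then have "face_coordinates P x \<kappa> \<in> topspace (nerve_space P {z \<in> P. m \<le> z \<and> z \<le> x})"
    unfolding topspace_nerve_space using sum face_weight_nonneg[OF P \<kappa>] above below chain
    by (auto simp: face_coordinates_def)
  with m that show thesis
    by blast
qed

lemma continuous_map_Max_insert:
  fixes f :: "'i \<Rightarrow> 'w \<Rightarrow> real"
  assumes "finite J" "\<And>i. i \<in> J \<Longrightarrow> continuous_map W euclideanreal (f i)"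
  shows "continuous_map W euclideanreal (\<lambda>w. Max (insert c ((\<lambda>i. f i w) ` J)))"
  using assms
proof (induction J rule: finite_induct)
  case (insert j J)
  have "Max (insert c ((\<lambda>i. f i w) ` insert j J)) = max (f j w) (Max (insert c ((\<lambda>i. f i w) ` J)))" for w
  proof -
    have "insert c ((\<lambda>i. f i w) ` insert j J) = insert (f j w) (insert c ((\<lambda>i. f i w) ` J))"
      by auto
    then show ?thesis
      using insert.hyps(1) by (metis Max_insert finite.insertI finite_imageI insert_not_empty)
  qed
  then show ?case
    using insert by (simp add: continuous_map_real_max)
qed auto

lemma continuous_map_face_coordinates:
  assumes P: "polyhedral_poset P" and x: "x \<in> P"
    and weights: "\<And>w. w \<in> topspace W \<Longrightarrow> weights_on P x (\<kappa> w)"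
    and cont: "\<And>v. v \<in> poset_vertices P \<Longrightarrow> continuous_map W euclideanreal (\<lambda>w. \<kappa> w v)"
  shows "continuous_map W (powertop_real P) (\<lambda>w. face_coordinates P x (\<kappa> w))"
proof -
  have outer: "continuous_map W euclideanreal (\<lambda>w. outer_weight P (\<kappa> w) z)" for z
    unfolding outer_weight_def using cont finite_poset_vertices[OF P]
    by (intro continuous_map_Max_insert) auto
  have face: "continuous_map W euclideanreal (\<lambda>w. face_weight P x (\<kappa> w) z)" for z
    using finite_polyhedral_poset[OF P] unfolding face_weight_def
    by (cases "z \<le> x") (auto intro!: continuous_intros outer)
  have "continuous_map W euclideanreal (\<lambda>w. face_coordinates P x (\<kappa> w) z)" if "z \<in> P" for z
  proof -
    have "(\<Sum>y\<in>P. face_weight P x (\<kappa> w) y) \<noteq> 0" if "w \<in> topspace W" for w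
      using sum_face_weight_pos[OF P x weights[OF that]] by simp
    then show ?thesis
      using finite_polyhedral_poset[OF P] that unfolding face_coordinates_def
      by (auto intro!: continuous_intros face)
  qed
  then show ?thesis
    unfolding continuous_map_componentwise by (auto simp: face_coordinates_def)
qed


section \<open>Chains in the nerve\<close>

definition apex :: "'p::order set \<Rightarrow> ('p \<Rightarrow> real) \<Rightarrow> 'p" where
  "apex P t = (THE m. m \<in> P \<and> t m \<noteq> 0 \<and> (\<forall>z\<in>P. t z \<noteq> 0 \<longrightarrow> m \<le> z))"

lemma apex:
  assumes "finite P" and t: "t \<in> topspace (nerve_space P S)"
  shows "apex P t \<in> P \<and> t (apex P t) \<noteq> 0 \<and> (\<forall>z\<in>P. t z \<noteq> 0 \<longrightarrow> apex P t \<le> z)"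
proof -
  let ?T = "{z \<in> P. t z \<noteq> 0}"
  have "(\<Sum>z\<in>P. t z) = 1"
    using t by (simp add: topspace_nerve_space)
  then have "?T \<noteq> {}"
    by (metis (mono_tags, lifting) empty_Collect_eq sum.neutral zero_neq_one)
  then obtain m where m: "m \<in> ?T" "\<And>y. y \<in> ?T \<Longrightarrow> y \<le> m \<Longrightarrow> m = y"
    using finite_has_minimal[of ?T] \<open>finite P\<close> by auto
  have "m \<le> z" if "z \<in> ?T" for z
  proof -
    have "m \<le> z \<or> z \<le> m"
      using t m(1) that by (simp add: topspace_nerve_space)
    with m(2)[OF that] show ?thesis
      by auto
  qed
  then have "\<forall>z\<in>P. t z \<noteq> 0 \<longrightarrow> m \<le> z"
    by blast
  with m(1) have "\<exists>!m. m \<in> P \<and> t m \<noteq> 0 \<and> (\<forall>z\<in>P. t z \<noteq> 0 \<longrightarrow> m \<le> z)"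
    by (intro ex1I[of _ m]) (simp_all add: order.antisym)
  then show ?thesis
    unfolding apex_def by (rule theI')
qed

text \<open>The support of \<open>t\<close> lies below \<open>x\<close> and that of \<open>t'\<close> above it, so their union is a chain.\<close>
lemma segment_in_nerve:
  assumes t: "t \<in> topspace (nerve_space P {z \<in> P. m \<le> z \<and> z \<le> x})"
    and t': "t' \<in> topspace (nerve_space P {z \<in> P. x \<le> z})"
    and "m \<le> x" and s: "s \<in> {0..1}"
  shows "(\<lambda>z\<in>P. (1 - s) * t z + s * t' z) \<in> topspace (nerve_space P {z \<in> P. m \<le> z})"
proof -
  have chain: "z \<le> w \<or> w \<le> z"
    if "z \<in> P" "w \<in> P" "t z \<noteq> 0 \<and> t w \<noteq> 0 \<or> t' z \<noteq> 0 \<and> t' w \<noteq> 0" for z w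
    using that t t' by (auto simp: topspace_nerve_space)
  have below: "m \<le> z \<and> z \<le> x" if "z \<in> P" "t z \<noteq> 0" for z
    using that t by (simp add: topspace_nerve_space)
  have above: "x \<le> z" if "z \<in> P" "t' z \<noteq> 0" for z
    using that t' by (simp add: topspace_nerve_space)
  have "(\<Sum>z\<in>P. (1 - s) * t z + s * t' z) = 1"
    using t t' by (simp add: topspace_nerve_space sum.distrib flip: sum_distrib_left)
  moreover have "(z \<le> w \<or> w \<le> z) \<and> m \<le> z"
    if "z \<in> P" "w \<in> P" "(1 - s) * t z + s * t' z \<noteq> 0" "(1 - s) * t w + s * t' w \<noteq> 0" for z w
  proof -
    have "t z \<noteq> 0 \<or> t' z \<noteq> 0" "t w \<noteq> 0 \<or> t' w \<noteq> 0"
      using that by auto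
    then show ?thesis
      using chain below above \<open>m \<le> x\<close> that(1,2) by (meson order_trans)
  qed
  moreover have "0 \<le> (1 - s) * t z + s * t' z" if "z \<in> P" for z
    using that t t' s by (simp add: topspace_nerve_space)
  ultimately show ?thesis
    by (simp add: topspace_nerve_space)
qed


section \<open>Products of NDR-pairs\<close>

lemma continuous_map_fst_snd: "continuous_map (prod_topology I (prod_topology A B)) A (\<lambda>w. fst (snd w))"
  using continuous_map_compose[OF continuous_map_snd continuous_map_fst] by (simp add: o_def)

lemma continuous_map_snd_snd: "continuous_map (prod_topology I (prod_topology A B)) B (\<lambda>w. snd (snd w))"
  using continuous_map_compose[OF continuous_map_snd continuous_map_snd] by (simp add: o_def)

locale NDR_family =
  fixes P :: "'p::order set" and X :: "'p \<Rightarrow> 'a topology" and A :: "'p \<Rightarrow> 'a set"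
    and u :: "'p \<Rightarrow> 'a \<Rightarrow> real" and h :: "'p \<Rightarrow> real \<times> 'a \<Rightarrow> 'a"
  assumes polyhedral: "polyhedral_poset P"
    and continuous_u: "v \<in> poset_vertices P \<Longrightarrow> continuous_map (X v) (top_of_set {0..1}) (u v)"
    and A_eq: "v \<in> poset_vertices P \<Longrightarrow> A v = {b \<in> topspace (X v). u v b = 0}"
    and continuous_h: "v \<in> poset_vertices P \<Longrightarrow>
      continuous_map (prod_topology (top_of_set {0..1}) (X v)) (X v) (h v)"
    and h_0: "v \<in> poset_vertices P \<Longrightarrow> b \<in> topspace (X v) \<Longrightarrow> h v (0, b) = b"
    and h_A: "v \<in> poset_vertices P \<Longrightarrow> s \<in> {0..1} \<Longrightarrow> b \<in> A v \<Longrightarrow> h v (s, b) = b"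
    and h_1: "v \<in> poset_vertices P \<Longrightarrow> b \<in> topspace (X v) \<Longrightarrow> u v b < 1 \<Longrightarrow> h v (1, b) \<in> A v"
begin

abbreviation "V \<equiv> poset_vertices P"
abbreviation "Z \<equiv> polyhedral_functor P X A"
abbreviation "Crel \<equiv> colim_rel P Z polyhedral_inclusion"
abbreviation "Hrel \<equiv> hocolim_rel P Z polyhedral_inclusion"
abbreviation "colim_Z \<equiv> colim P Z polyhedral_inclusion"
abbreviation "hocolim_Z \<equiv> hocolim P Z polyhedral_inclusion"
abbreviation "natural_map \<equiv> hocolim_to_colim P Z polyhedral_inclusion"
abbreviation "nerve_above x \<equiv> nerve_space P {z \<in> P. x \<le> z}"

lemma finite_P: "finite P"
  using polyhedral by (rule finite_polyhedral_poset)

lemma u_bounds: "v \<in> V \<Longrightarrow> b \<in> topspace (X v) \<Longrightarrow> 0 \<le> u v b \<and> u v b \<le> 1"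
  using continuous_map_image_subset_topspace[OF continuous_u[of v]] by force

lemma continuous_u_real: "v \<in> V \<Longrightarrow> continuous_map (X v) euclideanreal (u v)"
  using continuous_u continuous_map_in_subtopology by blast

lemma h_in: "v \<in> V \<Longrightarrow> s \<in> {0..1} \<Longrightarrow> b \<in> topspace (X v) \<Longrightarrow> h v (s, b) \<in> topspace (X v)"
  using continuous_map_image_subset_topspace[OF continuous_h[of v]] by force

lemma A_subset: "v \<in> V \<Longrightarrow> A v \<subseteq> topspace (X v)"
  using A_eq by auto

lemma closedin_A: "v \<in> V \<Longrightarrow> closedin (X v) (A v)"
  using closedin_continuous_map_preimage[OF continuous_u_real, of v "{0}"] A_eq[of v] by simp

lemma topspace_Z:
  "a \<in> topspace (Z x) \<longleftrightarrow>
     a \<in> extensional V \<and> (\<forall>v\<in>V. a v \<in> topspace (X v)) \<and>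
     (\<forall>v\<in>V - vertices_below P x. a v \<in> A v)"
  using A_subset unfolding polyhedral_functor_def by (auto simp: PiE_iff split: if_splits)

text \<open>Each product over \<open>x\<close> carries the subspace topology of the product of all \<open>X v\<close>, so for a map
with values in it continuity is a condition on coordinates that does not depend on \<open>x\<close>.\<close>
lemma continuous_map_into_Z:
  assumes "\<And>w. w \<in> topspace W \<Longrightarrow> \<alpha> w \<in> topspace (Z x)"
    and "\<And>v. v \<in> V \<Longrightarrow> continuous_map W (X v) (\<lambda>w. \<alpha> w v)"
  shows "continuous_map W (Z x) \<alpha>"
  using assms unfolding topspace_Z
  unfolding polyhedral_functor_def continuous_map_componentwise
  by (auto simp: continuous_map_in_subtopology)

lemma continuous_map_Z_component:
  assumes "v \<in> V"
  shows "continuous_map (Z x) (X v) (\<lambda>a. a v)"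
proof -
  have "continuous_map (Z x) (if v \<in> vertices_below P x then X v else subtopology (X v) (A v)) (\<lambda>a. a v)"
    unfolding polyhedral_functor_def using assms by (rule continuous_map_product_projection)
  then show ?thesis
    by (auto simp: continuous_map_in_subtopology split: if_splits)
qed

definition vertex_weights :: "('p \<Rightarrow> 'a) \<Rightarrow> 'p \<Rightarrow> real" where
  "vertex_weights a = (\<lambda>v. u v (a v))"

definition deform :: "real \<Rightarrow> ('p \<Rightarrow> 'a) \<Rightarrow> 'p \<Rightarrow> 'a" where
  "deform s a = (\<lambda>v\<in>V. h v (s, a v))"

lemma weights_on_vertex_weights:
  "a \<in> topspace (Z x) \<Longrightarrow> weights_on P x (vertex_weights a)"
  using u_bounds A_eq unfolding topspace_Z weights_on_def vertex_weights_def by auto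

lemma deform_in: "s \<in> {0..1} \<Longrightarrow> a \<in> topspace (Z x) \<Longrightarrow> deform s a \<in> topspace (Z x)"
  using h_in h_A unfolding topspace_Z deform_def by auto

lemma deform_0: "a \<in> topspace (Z x) \<Longrightarrow> deform 0 a = a"
  using h_0 unfolding topspace_Z deform_def by (auto simp: extensional_def)

text \<open>At a vertex that is not below \<open>m\<close> the weight is less than \<open>1\<close>, so the end of the deformation lies in \<open>A\<close> there.\<close>
lemma deform_1_in:
  assumes a: "a \<in> topspace (Z x)"
    and m: "{v \<in> V. vertex_weights a v = 1} \<subseteq> vertices_below P m"
  shows "deform 1 a \<in> topspace (Z m)"
proof -
  have "h v (1, a v) \<in> A v" if v: "v \<in> V" "v \<notin> vertices_below P m" for v
  proof -
    have "a v \<in> topspace (X v)"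
      using a v by (simp add: topspace_Z)
    moreover have "u v (a v) \<noteq> 1"
      using m v by (auto simp: vertex_weights_def)
    ultimately show ?thesis
      using h_1 u_bounds v by force
  qed
  then show ?thesis
    using a h_in unfolding topspace_Z deform_def by auto
qed

lemma continuous_map_deform_component:
  assumes "v \<in> V"
  shows "continuous_map (prod_topology (top_of_set {0..1}) (Z x)) (X v) (\<lambda>(s, a). deform s a v)"
proof -
  have "continuous_map (prod_topology (top_of_set {0..1}) (Z x)) (X v) (\<lambda>w. snd w v)"
    using continuous_map_compose[OF continuous_map_snd continuous_map_Z_component[OF assms]]
    by (simp add: o_def)
  then have "continuous_map (prod_topology (top_of_set {0..1}) (Z x))
      (prod_topology (top_of_set {0..1}) (X v)) (\<lambda>w. (fst w, snd w v))"
    by (intro continuous_map_pairedI continuous_map_fst)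
  from continuous_map_compose[OF this continuous_h[OF assms]] show ?thesis
    using assms by (simp add: deform_def o_def case_prod_unfold)
qed

lemma continuous_map_deform:
  "continuous_map (prod_topology (top_of_set {0..1}) (Z x)) (Z x) (\<lambda>(s, a). deform s a)"
  using continuous_map_deform_component
  by (intro continuous_map_into_Z) (auto simp: deform_in case_prod_unfold)

lemma continuous_map_deform_at:
  assumes "s \<in> {0..1}" "v \<in> V"
  shows "continuous_map (Z x) (X v) (\<lambda>a. deform s a v)"
proof -
  have "continuous_map (Z x) (prod_topology (top_of_set {0..1}) (Z x)) (\<lambda>a. (s, a))"
    using assms(1) by (intro continuous_map_pairedI) auto
  from continuous_map_compose[OF this continuous_map_deform_component[OF assms(2)]]
  show ?thesis
    by (simp add: o_def)
qed

lemma continuous_map_coordinates: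
  assumes "x \<in> P"
  shows "continuous_map (Z x) (powertop_real P) (\<lambda>a. face_coordinates P x (vertex_weights a))"
proof (rule continuous_map_face_coordinates[OF polyhedral assms])
  show "continuous_map (Z x) euclideanreal (\<lambda>a. vertex_weights a v)" if "v \<in> V" for v
    using continuous_map_compose[OF continuous_map_Z_component[OF that] continuous_u_real[OF that]]
    by (simp add: vertex_weights_def o_def)
qed (rule weights_on_vertex_weights)


section \<open>Points of the homotopy colimit\<close>

text \<open>The point of the homotopy colimit with coordinates \<open>a\<close> and \<open>t\<close>. Placing it over the apex
of \<open>t\<close> gives a representative that does not refer to an element of \<open>P\<close> chosen beforehand.\<close>
definition hpoint :: "('p \<Rightarrow> 'a) \<Rightarrow> ('p \<Rightarrow> real) \<Rightarrow> ('p \<times> ('p \<Rightarrow> 'a) \<times> ('p \<Rightarrow> real)) set" where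
  "hpoint a t = glue_class Hrel (apex P t, a, t)"

lemma hpoint_eq:
  assumes "x \<in> P" "a \<in> topspace (Z x)" "t \<in> topspace (nerve_above x)"
  shows "glue_class Hrel (x, a, t) = hpoint a t"
proof -
  have ap: "apex P t \<in> P \<and> t (apex P t) \<noteq> 0 \<and> (\<forall>z\<in>P. t z \<noteq> 0 \<longrightarrow> apex P t \<le> z)"
    using finite_P assms(3) by (rule apex)
  then have "x \<le> apex P t" "t \<in> topspace (nerve_above (apex P t))"
    using assms(3) by (auto simp: topspace_nerve_space)
  with ap assms have "((x, a, t), (apex P t, a, t)) \<in> Hrel"
    unfolding hocolim_rel_def by (force simp: polyhedral_inclusion_def)
  then show ?thesis
    unfolding hpoint_def by (rule glue_class_eqI)
qed

lemma continuous_map_hocolim_point: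
  assumes "x \<in> P"
  shows "continuous_map (prod_topology (Z x) (nerve_above x)) hocolim_Z (\<lambda>p. glue_class Hrel (x, p))"
  using continuous_map_compose[OF
      continuous_map_component_injection[OF assms, of "\<lambda>x. prod_topology (Z x) (nerve_above x)"]
      quotient_imp_continuous_map[OF quotient_map_glue_class]]
  by (simp add: hocolim_def o_def)

lemma continuous_map_colim_point:
  assumes "x \<in> P"
  shows "continuous_map (Z x) colim_Z (\<lambda>a. glue_class Crel (x, a))"
  using continuous_map_compose[OF continuous_map_component_injection[OF assms, of Z]
      quotient_imp_continuous_map[OF quotient_map_glue_class]]
  by (simp add: colim_def o_def)

text \<open>The apex of \<open>\<tau> w\<close> need not be locally constant in \<open>w\<close>. It is enough, however, to have a finite closed cover
on whose members the point can be placed over a fixed element; the sets \<open>T y\<close> of the proof form one, since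
\<open>A v\<close> is closed in \<open>X v\<close> and the vanishing of a barycentric coordinate is a closed condition.\<close>
lemma continuous_map_hpoint:
  assumes \<alpha>: "\<And>v. v \<in> V \<Longrightarrow> continuous_map W (X v) (\<lambda>w. \<alpha> w v)"
    and \<tau>: "continuous_map W (powertop_real P) \<tau>"
    and face: "\<And>w. w \<in> topspace W \<Longrightarrow>
      \<exists>m\<in>P. \<alpha> w \<in> topspace (Z m) \<and> \<tau> w \<in> topspace (nerve_above m)"
  shows "continuous_map W hocolim_Z (\<lambda>w. hpoint (\<alpha> w) (\<tau> w))"
proof -
  define T where "T y = {w \<in> topspace W.
      (\<forall>v\<in>V - vertices_below P y. \<alpha> w v \<in> A v) \<and> (\<forall>z\<in>{z\<in>P. \<not> y \<le> z}. \<tau> w z = 0)}" for y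
  have T: "\<alpha> w \<in> topspace (Z y) \<and> \<tau> w \<in> topspace (nerve_above y)" if "w \<in> T y" for w y
  proof -
    from that have w: "w \<in> topspace W" "\<And>v. v \<in> V \<Longrightarrow> v \<notin> vertices_below P y \<Longrightarrow> \<alpha> w v \<in> A v"
        "\<And>z. z \<in> P \<Longrightarrow> \<tau> w z \<noteq> 0 \<Longrightarrow> y \<le> z"
      by (auto simp: T_def)
    obtain m where m: "m \<in> P" "\<alpha> w \<in> topspace (Z m)" "\<tau> w \<in> topspace (nerve_above m)"
      using face[OF w(1)] by blast
    have "\<alpha> w \<in> topspace (Z y)"
      using m(2) w(2) by (simp add: topspace_Z)
    moreover have "\<tau> w \<in> topspace (nerve_above y)"
      using m(3) w(3) by (simp add: topspace_nerve_space)
    ultimately show ?thesis ..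
  qed
  have coordinate: "continuous_map W euclideanreal (\<lambda>w. \<tau> w z)" if "z \<in> P" for z
    using \<tau> that by (simp add: continuous_map_componentwise)
  show ?thesis
  proof (rule pasting_lemma_closed[where I = P and T = T and f = "\<lambda>_ w. hpoint (\<alpha> w) (\<tau> w)"])
    fix y assume y: "y \<in> P"
    show "closedin W (T y)"
    proof -
      let ?K = "insert (topspace W)
        ((\<lambda>v. {w \<in> topspace W. \<alpha> w v \<in> A v}) ` (V - vertices_below P y) \<union>
         (\<lambda>z. {w \<in> topspace W. \<tau> w z \<in> {0}}) ` {z\<in>P. \<not> y \<le> z})"
      have "closedin W {w \<in> topspace W. \<alpha> w v \<in> A v}" if "v \<in> V" for v
        using closedin_continuous_map_preimage[OF \<alpha> closedin_A] that by blast
      moreover have "closedin W {w \<in> topspace W. \<tau> w z \<in> {0}}" if "z \<in> P" for z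
        using closedin_continuous_map_preimage[OF coordinate[OF that], of "{0}"] by simp
      ultimately have "closedin W (\<Inter>?K)"
        by (intro closedin_Inter) auto
      moreover have "T y = \<Inter>?K"
        by (auto simp: T_def)
      ultimately show ?thesis
        by simp
    qed
    have W: "topspace (subtopology W (T y)) = T y"
      by (auto simp: T_def)
    have "continuous_map (subtopology W (T y)) (Z y) \<alpha>"
      by (rule continuous_map_into_Z) (auto simp: W T \<alpha> continuous_map_from_subtopology)
    moreover have "continuous_map (subtopology W (T y)) (nerve_above y) \<tau>"
      using T[of _ y] \<tau> unfolding nerve_space_def
      by (auto simp: continuous_map_in_subtopology continuous_map_from_subtopology W)
    ultimately have "continuous_map (subtopology W (T y)) (prod_topology (Z y) (nerve_above y))
        (\<lambda>w. (\<alpha> w, \<tau> w))"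
      by (rule continuous_map_pairedI)
    from continuous_map_compose[OF this continuous_map_hocolim_point[OF y]]
    have "continuous_map (subtopology W (T y)) hocolim_Z (\<lambda>w. glue_class Hrel (y, \<alpha> w, \<tau> w))"
      by (simp add: o_def)
    then show "continuous_map (subtopology W (T y)) hocolim_Z (\<lambda>w. hpoint (\<alpha> w) (\<tau> w))"
      by (rule continuous_map_eq) (use T hpoint_eq[OF y] W in auto)
  next
    fix w assume w: "w \<in> topspace W"
    then obtain m where "m \<in> P" "\<alpha> w \<in> topspace (Z m)" "\<tau> w \<in> topspace (nerve_above m)"
      using face by blast
    with w show "\<exists>j. j \<in> P \<and> w \<in> T j \<and> hpoint (\<alpha> w) (\<tau> w) = hpoint (\<alpha> w) (\<tau> w)"
      unfolding T_def topspace_Z topspace_nerve_space by blast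
  qed (auto simp: finite_P)
qed


section \<open>The homotopy inverse\<close>

lemma colim_rel_Z:
  "(p, q) \<in> Crel \<longleftrightarrow>
     (\<exists>x y a. p = (x, a) \<and> q = (y, a) \<and> x \<in> P \<and> y \<in> P \<and> x \<le> y \<and> a \<in> topspace (Z x))"
  by (auto simp: colim_rel_def polyhedral_inclusion_def)

lemma hocolim_rel_Z:
  "(p, q) \<in> Hrel \<longleftrightarrow>
     (\<exists>x y a t. p = (x, a, t) \<and> q = (y, a, t) \<and> x \<in> P \<and> y \<in> P \<and> x \<le> y \<and>
        a \<in> topspace (Z x) \<and> t \<in> topspace (nerve_above y))"
  by (auto simp: hocolim_rel_def polyhedral_inclusion_def)

definition coordinates :: "'p \<Rightarrow> ('p \<Rightarrow> 'a) \<Rightarrow> 'p \<Rightarrow> real" where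
  "coordinates x a = face_coordinates P x (vertex_weights a)"

lemma coordinates_independent:
  assumes "x \<in> P" "y \<in> P" "x \<le> y" "a \<in> topspace (Z x)"
  shows "coordinates x a = coordinates y a"
  unfolding coordinates_def
  using assms polyhedral weights_on_vertex_weights by (intro face_coordinates_independent) auto

text \<open>The deformed point lies over an element below the whole chain of its coordinates, so that together they form
a point of the homotopy colimit: the value of the homotopy inverse. The upper bound \<open>x\<close> on the chain is what the segments of
\<open>hocolim_slide_homotopic\<close> need.\<close>
lemma pushed_face:
  assumes "x \<in> P" "a \<in> topspace (Z x)"
  obtains m where "m \<in> P" "m \<le> x" "deform 1 a \<in> topspace (Z m)"
    "coordinates x a \<in> topspace (nerve_space P {z \<in> P. m \<le> z \<and> z \<le> x})"
proof -
  obtain m where m: "m \<in> P" "m \<le> x" "{v \<in> V. vertex_weights a v = 1} \<subseteq> vertices_below P m"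
      "face_coordinates P x (vertex_weights a) \<in> topspace (nerve_space P {z \<in> P. m \<le> z \<and> z \<le> x})"
    using face_coordinates_in_nerve[OF polyhedral assms(1) weights_on_vertex_weights[OF assms(2)]] .
  show thesis
    using that[OF m(1,2) deform_1_in[OF assms(2) m(3)]] m(4) by (simp add: coordinates_def)
qed

lemma nerve_interval_subset:
  "t \<in> topspace (nerve_space P {z \<in> P. m \<le> z \<and> z \<le> x}) \<Longrightarrow> t \<in> topspace (nerve_above m)"
  by (auto simp: topspace_nerve_space)

definition homotopy_inverse :: "('p \<times> ('p \<Rightarrow> 'a)) set \<Rightarrow> ('p \<times> ('p \<Rightarrow> 'a) \<times> ('p \<Rightarrow> real)) set" where
  "homotopy_inverse = lift_class (\<lambda>(x, a). hpoint (deform 1 a) (coordinates x a))"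

lemma homotopy_inverse_respects_colim_rel:
  assumes "(p, q) \<in> Crel"
  shows "(case p of (x, a) \<Rightarrow> hpoint (deform 1 a) (coordinates x a)) =
    (case q of (x, a) \<Rightarrow> hpoint (deform 1 a) (coordinates x a))"
proof -
  obtain x y a where "p = (x, a)" "q = (y, a)" "x \<in> P" "y \<in> P" "x \<le> y" "a \<in> topspace (Z x)"
    using assms colim_rel_Z by auto
  then show ?thesis
    using coordinates_independent[of x y a] by simp
qed

lemma homotopy_inverse_eq:
  "homotopy_inverse (glue_class Crel (x, a)) = hpoint (deform 1 a) (coordinates x a)"
  unfolding homotopy_inverse_def
  using lift_class_eq[of Crel, OF homotopy_inverse_respects_colim_rel] by simp

lemma continuous_map_homotopy_inverse: "continuous_map colim_Z hocolim_Z homotopy_inverse"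
  unfolding colim_def homotopy_inverse_def
proof (rule continuous_map_from_glued)
  fix x assume x: "x \<in> P"
  show "continuous_map (Z x) hocolim_Z (\<lambda>a. case (x, a) of (x, a) \<Rightarrow> hpoint (deform 1 a) (coordinates x a))"
    unfolding prod.case
  proof (rule continuous_map_hpoint)
    show "continuous_map (Z x) (powertop_real P) (coordinates x)"
      using continuous_map_coordinates[OF x] by (simp add: coordinates_def[abs_def])
    show "\<exists>m\<in>P. deform 1 a \<in> topspace (Z m) \<and> coordinates x a \<in> topspace (nerve_above m)"
      if a: "a \<in> topspace (Z x)" for a
    proof -
      obtain m where "m \<in> P" "deform 1 a \<in> topspace (Z m)"
          "coordinates x a \<in> topspace (nerve_space P {z \<in> P. m \<le> z \<and> z \<le> x})"
        using pushed_face[OF x a] .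
      then show ?thesis
        using nerve_interval_subset by blast
    qed
  qed (auto intro: continuous_map_deform_at)
qed (rule homotopy_inverse_respects_colim_rel)

lemma continuous_map_natural: "continuous_map hocolim_Z colim_Z natural_map"
proof -
  let ?pr = "\<lambda>(x, a, t). glue_class Crel (x, a)"
  have "continuous_map (sum_topology (\<lambda>x. prod_topology (Z x) (nerve_above x)) P) colim_Z ?pr"
  proof (rule continuous_map_from_sum_topology)
    fix x assume "x \<in> P"
    from continuous_map_compose[OF continuous_map_fst continuous_map_colim_point[OF this]]
    show "continuous_map (prod_topology (Z x) (nerve_above x)) colim_Z (\<lambda>p. ?pr (x, p))"
      by (simp add: o_def case_prod_unfold)
  qed
  moreover have "?pr = natural_map \<circ> glue_class Hrel"
    by (auto simp: fun_eq_iff hocolim_to_colim_class)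
  ultimately show ?thesis
    unfolding hocolim_def using continuous_compose_quotient_map[OF quotient_map_glue_class] by simp
qed

lemma natural_hpoint:
  assumes "m \<in> P" "a \<in> topspace (Z m)" "t \<in> topspace (nerve_above m)"
  shows "natural_map (hpoint a t) = glue_class Crel (m, a)"
  using hpoint_eq[OF assms, symmetric] by (simp add: hocolim_to_colim_class)


section \<open>The two homotopies\<close>

lemma natural_inverse_homotopic:
  "homotopic_with (\<lambda>_. True) colim_Z colim_Z
     id (natural_map \<circ> homotopy_inverse)"
  unfolding colim_def[of P Z]
proof (rule homotopic_with_glued[where H = "\<lambda>s (x, a). glue_class Crel (x, deform s a)"])
  fix x assume x: "x \<in> P"
  show "continuous_map (prod_topology (top_of_set {0..1}) (Z x)) (quotient_space (sum_topology Z P) Crel)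
      (\<lambda>(s, a). case (x, a) of (x, a) \<Rightarrow> glue_class Crel (x, deform s a))"
    using continuous_map_compose[OF continuous_map_deform continuous_map_colim_point[OF x]]
    by (simp add: colim_def o_def case_prod_unfold)
  fix a assume a: "a \<in> topspace (Z x)"
  then show "(case (x, a) of (x, a) \<Rightarrow> glue_class Crel (x, deform 0 a)) = id (glue_class Crel (x, a))"
    by (simp add: deform_0)
  obtain m where m: "m \<in> P" "m \<le> x" "deform 1 a \<in> topspace (Z m)"
      "coordinates x a \<in> topspace (nerve_space P {z \<in> P. m \<le> z \<and> z \<le> x})"
    using pushed_face[OF x a] .
  then have "glue_class Crel (m, deform 1 a) = glue_class Crel (x, deform 1 a)"
    using x by (intro glue_class_eqI) (simp add: colim_rel_Z)
  then show "(case (x, a) of (x, a) \<Rightarrow> glue_class Crel (x, deform 1 a)) =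
      (natural_map \<circ> homotopy_inverse) (glue_class Crel (x, a))"
    using natural_hpoint[OF m(1,3) nerve_interval_subset[OF m(4)]] by (simp add: homotopy_inverse_eq)
next
  fix s :: real and p q assume "s \<in> {0..1}" "(p, q) \<in> Crel"
  then show "(case p of (x, a) \<Rightarrow> glue_class Crel (x, deform s a)) =
      (case q of (x, a) \<Rightarrow> glue_class Crel (x, deform s a))"
    by (auto simp: colim_rel_Z deform_in intro!: glue_class_eqI)
qed

lemma deform_respects_hocolim_rel:
  assumes "s \<in> {0..1}" "(p, q) \<in> Hrel"
  shows "(case p of (x, a, t) \<Rightarrow> glue_class Hrel (x, deform s a, t)) =
    (case q of (x, a, t) \<Rightarrow> glue_class Hrel (x, deform s a, t))"
proof -
  obtain x y a t where pq: "p = (x, a, t)" "q = (y, a, t)"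
    and *: "x \<in> P" "y \<in> P" "x \<le> y" "a \<in> topspace (Z x)" "t \<in> topspace (nerve_above y)"
    using assms(2) hocolim_rel_Z by auto
  then have "((x, deform s a, t), (y, deform s a, t)) \<in> Hrel"
    using deform_in[OF assms(1)] by (simp add: hocolim_rel_Z)
  then have "glue_class Hrel (x, deform s a, t) = glue_class Hrel (y, deform s a, t)"
    by (rule glue_class_eqI)
  then show ?thesis
    by (simp add: pq)
qed

definition hocolim_push ::
    "('p \<times> ('p \<Rightarrow> 'a) \<times> ('p \<Rightarrow> real)) set \<Rightarrow> ('p \<times> ('p \<Rightarrow> 'a) \<times> ('p \<Rightarrow> real)) set" where
  "hocolim_push = lift_class (\<lambda>(x, a, t). glue_class Hrel (x, deform 1 a, t))"

lemma hocolim_push_eq: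
  "hocolim_push (glue_class Hrel (x, a, t)) = glue_class Hrel (x, deform 1 a, t)"
  unfolding hocolim_push_def
  using lift_class_eq[of Hrel, OF deform_respects_hocolim_rel[of 1]] by simp

lemma hocolim_push_homotopic:
  "homotopic_with (\<lambda>_. True) hocolim_Z hocolim_Z id hocolim_push"
  unfolding hocolim_def[of P Z]
proof (rule homotopic_with_glued[where H = "\<lambda>s (x, a, t). glue_class Hrel (x, deform s a, t)"])
  fix x assume x: "x \<in> P"
  let ?W = "prod_topology (top_of_set {0..1::real}) (prod_topology (Z x) (nerve_above x))"
  have "continuous_map ?W (prod_topology (top_of_set {0..1}) (Z x)) (\<lambda>w. (fst w, fst (snd w)))"
    by (intro continuous_map_pairedI continuous_map_fst continuous_map_fst_snd)
  from continuous_map_compose[OF this continuous_map_deform]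
  have "continuous_map ?W (Z x) (\<lambda>w. deform (fst w) (fst (snd w)))"
    by (simp add: o_def)
  moreover have "continuous_map ?W (nerve_above x) (\<lambda>w. snd (snd w))"
    by (rule continuous_map_snd_snd)
  ultimately have "continuous_map ?W (prod_topology (Z x) (nerve_above x))
      (\<lambda>w. (deform (fst w) (fst (snd w)), snd (snd w)))"
    by (rule continuous_map_pairedI)
  from continuous_map_compose[OF this continuous_map_hocolim_point[OF x]]
  show "continuous_map ?W
      (quotient_space (sum_topology (\<lambda>x. prod_topology (Z x) (nerve_above x)) P) Hrel)
      (\<lambda>(s, p). case (x, p) of (x, a, t) \<Rightarrow> glue_class Hrel (x, deform s a, t))"
    by (simp add: hocolim_def o_def case_prod_unfold)
  fix p assume p: "p \<in> topspace (prod_topology (Z x) (nerve_above x))"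
  then show "(case (x, p) of (x, a, t) \<Rightarrow> glue_class Hrel (x, deform 0 a, t)) = id (glue_class Hrel (x, p))"
    by (auto simp: deform_0)
  show "(case (x, p) of (x, a, t) \<Rightarrow> glue_class Hrel (x, deform 1 a, t)) =
      hocolim_push (glue_class Hrel (x, p))"
    by (cases p) (simp add: hocolim_push_eq)
qed (rule deform_respects_hocolim_rel)

text \<open>The first coordinate \<open>deform 1 a\<close> stays fixed while the second one runs along the segment from
\<open>coordinates x a\<close> to \<open>t\<close>. For \<open>s < 1\<close> the apex is that of \<open>coordinates x a\<close>, and at \<open>s = 1\<close> it
may jump to that of \<open>t\<close>; this is absorbed by \<open>continuous_map_hpoint\<close>.\<close>
lemma hocolim_slide_homotopic:
  "homotopic_with (\<lambda>_. True) hocolim_Z hocolim_Z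
     (homotopy_inverse \<circ> natural_map) hocolim_push"
proof -
  let ?slide = "\<lambda>s x a t. \<lambda>z\<in>P. (1 - s) * coordinates x a z + s * t z"
  have face: "\<exists>m\<in>P. deform 1 a \<in> topspace (Z m) \<and> ?slide s x a t \<in> topspace (nerve_above m)"
    if x: "x \<in> P" and s: "s \<in> {0..1}" and a: "a \<in> topspace (Z x)"
      and t: "t \<in> topspace (nerve_above x)" for s x a t
  proof -
    obtain m where m: "m \<in> P" "m \<le> x" "deform 1 a \<in> topspace (Z m)"
        "coordinates x a \<in> topspace (nerve_space P {z \<in> P. m \<le> z \<and> z \<le> x})"
      using pushed_face[OF x a] .
    then show ?thesis
      using segment_in_nerve[OF m(4) t m(2) s] m(1,3) by blast
  qed
  show ?thesis
    unfolding hocolim_def[of P Z]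
  proof (rule homotopic_with_glued[where H = "\<lambda>s (x, a, t). hpoint (deform 1 a) (?slide s x a t)"])
    fix x assume x: "x \<in> P"
    let ?W = "prod_topology (top_of_set {0..1::real}) (prod_topology (Z x) (nerve_above x))"
    have "continuous_map ?W hocolim_Z (\<lambda>w. hpoint (deform 1 (fst (snd w))) (?slide (fst w) x (fst (snd w)) (snd (snd w))))"
    proof (rule continuous_map_hpoint)
      have proj: "continuous_map ?W (Z x) (\<lambda>w. fst (snd w))"
          "continuous_map ?W (nerve_above x) (\<lambda>w. snd (snd w))"
        by (rule continuous_map_fst_snd continuous_map_snd_snd)+
      show "continuous_map ?W (X v) (\<lambda>w. deform 1 (fst (snd w)) v)" if "v \<in> V" for v
        using continuous_map_compose[OF proj(1) continuous_map_deform_at[OF _ that]] by (simp add: o_def)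
      have "continuous_map (Z x) euclideanreal (\<lambda>a. coordinates x a z)" if "z \<in> P" for z
        using continuous_map_coordinates[OF x] that
        by (simp add: coordinates_def continuous_map_componentwise)
      then have c: "continuous_map ?W euclideanreal (\<lambda>w. coordinates x (fst (snd w)) z)" if "z \<in> P" for z
        using continuous_map_compose[OF proj(1), of euclideanreal "\<lambda>a. coordinates x a z"] that
        by (simp add: o_def)
      have "continuous_map (nerve_above x) euclideanreal (\<lambda>t. t z)" if "z \<in> P" for z
        unfolding nerve_space_def using that
        by (intro continuous_map_from_subtopology continuous_map_product_projection)
      then have t: "continuous_map ?W euclideanreal (\<lambda>w. snd (snd w) z)" if "z \<in> P" for z
        using continuous_map_compose[OF proj(2), of euclideanreal "\<lambda>t. t z"] that
        by (simp add: o_def)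
      have "continuous_map ?W (top_of_set {0..1}) fst"
        by (rule continuous_map_fst)
      then have "continuous_map ?W euclideanreal fst"
        using continuous_map_in_subtopology by blast
      then show "continuous_map ?W (powertop_real P) (\<lambda>w. ?slide (fst w) x (fst (snd w)) (snd (snd w)))"
        unfolding continuous_map_componentwise
        by (auto intro!: continuous_intros c t)
      show "\<exists>m\<in>P. deform 1 (fst (snd w)) \<in> topspace (Z m) \<and>
          ?slide (fst w) x (fst (snd w)) (snd (snd w)) \<in> topspace (nerve_above m)"
        if "w \<in> topspace ?W" for w
        using that by (intro face[OF x]) auto
    qed
    then show "continuous_map ?W
        (quotient_space (sum_topology (\<lambda>x. prod_topology (Z x) (nerve_above x)) P) Hrel)
        (\<lambda>(s, p). case (x, p) of (x, a, t) \<Rightarrow> hpoint (deform 1 a) (?slide s x a t))"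
      by (simp add: hocolim_def case_prod_unfold)
    fix p assume "p \<in> topspace (prod_topology (Z x) (nerve_above x))"
    then obtain a t where p: "p = (a, t)" and a: "a \<in> topspace (Z x)" and t: "t \<in> topspace (nerve_above x)"
      by auto
    have "?slide 0 x a t = coordinates x a"
      by (auto simp: coordinates_def face_coordinates_def)
    then show "(case (x, p) of (x, a, t) \<Rightarrow> hpoint (deform 1 a) (?slide 0 x a t)) =
        (homotopy_inverse \<circ> natural_map) (glue_class Hrel (x, p))"
      by (simp add: p hocolim_to_colim_class homotopy_inverse_eq)
    have "?slide 1 x a t = t"
      using t by (auto simp: topspace_nerve_space extensional_def)
    then show "(case (x, p) of (x, a, t) \<Rightarrow> hpoint (deform 1 a) (?slide 1 x a t)) =
        hocolim_push (glue_class Hrel (x, p))"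
      using hpoint_eq[OF x deform_in[OF _ a] t, of 1] by (simp add: p hocolim_push_eq)
  next
    fix s :: real and p q assume "s \<in> {0..1}" "(p, q) \<in> Hrel"
    then obtain x y a t where "p = (x, a, t)" "q = (y, a, t)" "x \<in> P" "y \<in> P" "x \<le> y"
        "a \<in> topspace (Z x)"
      using hocolim_rel_Z by auto
    then show "(case p of (x, a, t) \<Rightarrow> hpoint (deform 1 a) (?slide s x a t)) =
        (case q of (x, a, t) \<Rightarrow> hpoint (deform 1 a) (?slide s x a t))"
      using coordinates_independent[of x y a] by simp
  qed
qed

theorem homotopy_equivalence_natural:
  "homotopy_equivalence_map hocolim_Z colim_Z natural_map"
  unfolding homotopy_equivalence_map_def
proof (intro conjI exI[of _ homotopy_inverse])
  show "homotopic_with (\<lambda>_. True) hocolim_Z hocolim_Z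
      (homotopy_inverse \<circ> natural_map) id"
    using hocolim_slide_homotopic homotopic_with_symD[OF hocolim_push_homotopic]
    by (rule homotopic_with_trans)
  show "homotopic_with (\<lambda>_. True) colim_Z colim_Z
      (natural_map \<circ> homotopy_inverse) id"
    using natural_inverse_homotopic by (rule homotopic_with_symD)
qed (rule continuous_map_natural continuous_map_homotopy_inverse)+

end

theorem proposition5p6:
  fixes P :: "'p::order set" and X :: "'p \<Rightarrow> 'a topology" and A :: "'p \<Rightarrow> 'a set"
  assumes "polyhedral_poset P" and "reduced_poset P"
    and "\<And>v. v \<in> poset_vertices P \<Longrightarrow> NDR_pair (X v) (A v)"
    and "\<And>v. v \<in> poset_vertices P \<Longrightarrow> topspace (X v) \<noteq> A v"
  shows "homotopy_equivalence_map
           (hocolim P (polyhedral_functor P X A) polyhedral_inclusion)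
           (colim P (polyhedral_functor P X A) polyhedral_inclusion)
           (hocolim_to_colim P (polyhedral_functor P X A) polyhedral_inclusion)"
proof -
  \<comment> \<open>Packing the NDR conditions into one predicate lets \<open>u\<close> and \<open>h\<close> be chosen for all vertices at once.\<close>
  define data where "data v u h \<longleftrightarrow>
      continuous_map (X v) (top_of_set {0..1::real}) u \<and>
      A v = {x \<in> topspace (X v). u x = 0} \<and>
      continuous_map (prod_topology (top_of_set {0..1::real}) (X v)) (X v) h \<and>
      (\<forall>x\<in>topspace (X v). h (0, x) = x) \<and>
      (\<forall>t\<in>{0..1}. \<forall>a\<in>A v. h (t, a) = a) \<and>
      (\<forall>x\<in>topspace (X v). u x < 1 \<longrightarrow> h (1, x) \<in> A v)" for v u h
  have "\<forall>v\<in>poset_vertices P. \<exists>u h. data v u h"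
    using assms(3) unfolding NDR_pair_def data_def by simp
  then obtain u h where "\<forall>v\<in>poset_vertices P. data v (u v) (h v)"
    by metis
  then interpret NDR_family P X A u h
    using assms(1) unfolding data_def by unfold_locales blast+
  show ?thesis
    by (rule homotopy_equivalence_natural)
qed

end
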